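(* Let $\{P_n\}_{n\ge 0}$ be a two-orthogonal monic polynomial sequence with structure coefficients $\{\beta_n\}_{n\ge 0}$, $\{\alpha_n\}_{n\ge 1}$, $\{\gamma_n\}_{n\ge 1}$ and dual sequence $\{u_n\}_{n\ge 0}$. Let $J=a_0(x)I+a_1(x)D+\frac{a_2(x)}{2}D^2$ be a lowering operator of order one such that $$J(P_{n+1})(x)=\lambda_{n+1}^{[1]}P_n(x),\quad n\ge 0,$$ where $\lambda_{n+1}^{[1]}=(n+1)a_0^{[1]}+\frac{n(n+1)}{2}a_1^{[2]}\neq 0$ for $n\ge 0$. Then the vector of forms $U=(u_0,u_1)^T$ fulfils $$D(\Phi U)+\Psi U=0,$$ with $$\Psi(x)=\begin{bmatrix}0&1\\ \frac{2}{\gamma_1}(x-\beta_0)&-2\frac{\alpha_1}{\gamma_1}\end{bmatrix},\qquad \Phi(x)=\begin{bmatrix}\phi_{1,1}(x)&\phi_{1,2}(x)\\ \phi_{2,1}(x)&\phi_{2,2}(x)\end{bmatrix},$$ where $$\phi_{1,1}(x)=\frac12-\frac{\alpha_1\lambda_2^{[1]}}{2\lambda_1^{[1]}}E_1(x)-\frac{\gamma_1\lambda_3^{[1]}}{2\lambda_1^{[1]}}B_1(x),$$ $$\phi_{1,2}(x)=\frac12(x-\beta_0)-\frac{\alpha_1\lambda_2^{[1]}}{2\lambda_1^{[1]}}A_0(x)-\frac{\gamma_1\lambda_3^{[1]}}{2\lambda_1^{[1]}}F_1(x),$$ $$\phi_{2,1}(x)=(x-\beta_1)E_1(x)-\frac{\alpha_2\lambda_3^{[1]}}{\lambda_2^{[1]}}B_1(x)-\frac{\gamma_2\lambda_4^{[1]}}{\lambda_2^{[1]}}E_2(x),$$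 $$\phi_{2,2}(x)=(x-\beta_1)A_0(x)-\frac{\alpha_2\lambda_3^{[1]}}{\lambda_2^{[1]}}F_1(x)-\frac{\gamma_2\lambda_4^{[1]}}{\lambda_2^{[1]}}A_1(x),$$ and $E_1,A_0,B_1,F_1,E_2,A_1$ are the polynomials $$E_1(x)=\frac{1}{\gamma_1}(x-\beta_0),\quad A_0(x)=-\frac{\alpha_1}{\gamma_1},\quad B_1(x)=-\frac{\alpha_2}{\gamma_1\gamma_2}(x-\beta_0)-\frac{1}{\gamma_2},$$ $$F_1(x)=\frac{1}{\gamma_2}\left(x-\beta_1+\frac{\alpha_2\alpha_1}{\gamma_1}\right),\quad E_2(x)=\frac{1}{\gamma_3}\big((x-\beta_2)E_1(x)-\alpha_3B_1(x)\big),$$ $$A_1(x)=-\frac{1}{\gamma_3}\left(\alpha_3F_1(x)+1+\frac{\alpha_1}{\gamma_1}(x-\beta_2)\right).$$ Consequently, $\{P_n\}_{n\ge 0}$ is two-classical in Hahn's sense.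
   Context: $\mathcal{P}$ is the vector space of polynomials in $x$ with coefficients in $\mathbb{C}$, $\mathcal{P}'$ its (algebraic) dual, $\langle u,p\rangle$ the action of $u\in\mathcal{P}'$ on $p\in\mathcal{P}$. For $f\in\mathcal{P}$, $u\in\mathcal{P}'$: $\langle fu,p\rangle=\langle u,fp\rangle$ and $\langle Du,p\rangle=-\langle u,p'\rangle$ for all $p\in\mathcal{P}$; on $\mathcal{P}$, $D$ is the usual derivative and $I$ the identity. A matrix of polynomials acts on a column vector of forms by the usual matrix product using $fu$, and $D$ acts on vectors of forms componentwise. A monic polynomial sequence (MPS) is a sequence $\{P_n\}_{n\ge 0}$ of monic polynomials with $\deg P_n=n$. Its dual sequence is the unique sequence $\{u_n\}_{n\ge 0}$ in $\mathcal{P}'$ with $\langle u_n,P_m\rangle=\delta_{n,m}$ for all $n,m\ge 0$. A MPS $\{P_n\}_{n\ge 0}$ is two-orthogonal with structure coefficients $\{\beta_n\}_{n\ge 0}$, $\{\alpha_n\}_{n\ge 1}$, $\{\gamma_n\}_{n\ge 1}$ (complex numbers, $\gamma_{n+1}\ne 0$ for all $n\ge 0$) if $$P_0(x)=1,\quad P_1(x)=x-\beta_0,\quad P_2(x)=(x-\beta_1)P_1(x)-\alpha_1,$$ $$P_{n+3}(x)=(x-\beta_{n+2})P_{n+2}(x)-\alpha_{n+2}P_{n+1}(x)-\gamma_{n+1}P_n(x),\quad n\ge 0.$$ A two-orthogonal MPS $\{P_n\}_{n\ge 0}$ is two-classical in Hahn's sense if the MPS $\{P_n^{[1]}\}_{n\ge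 0}$ defined by $P_n^{[1]}(x)=(n+1)^{-1}P_{n+1}'(x)$ is also two-orthogonal. Writing $a_\nu(x)=\sum_{i=0}^{\nu}a_i^{[\nu]}x^i$ ($\nu=0,1,2$), $J$ is a lowering operator of order one if $J(1)=0$, $J(x)=a_0^{[1]}\ne 0$ and $\deg J(x^{n+1})=n$ for all $n\ge 0$; equivalently, $a_0(x)=0$, $a_1(x)=a_0^{[1]}$ is constant, $a_2(x)=a_0^{[2]}+a_1^{[2]}x$, and $\lambda_{n+1}^{[1]}=(n+1)a_0^{[1]}+\frac{n(n+1)}{2}a_1^{[2]}\neq 0$ for all $n\ge 0$. *)

theory Defs
  imports "HOL-Analysis.Analysis" "HOL-Computational_Algebra.Polynomial"
    "HOL-Library.Function_Algebras"
begin

text \<open>Forms are functions on polynomials that belong to \<open>dual_space\<close>; their sums and the zero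
  form are the pointwise ones of \<open>Function_Algebras\<close>.\<close>

type_synonym form = "complex poly \<Rightarrow> complex"

definition dual_space :: "form set" where
  "dual_space = {u. Vector_Spaces.linear smult (*) u}"

definition form_mult :: "complex poly \<Rightarrow> form \<Rightarrow> form" where
  "form_mult f u = (\<lambda>p. u (f * p))"

definition form_deriv :: "form \<Rightarrow> form" where
  "form_deriv u = (\<lambda>p. - u (pderiv p))"

lemma form_mult_in_dual_space: "u \<in> dual_space \<Longrightarrow> form_mult f u \<in> dual_space"
  unfolding dual_space_def form_mult_def mem_Collect_eq Vector_Spaces.linear_iff
  by (simp add: distrib_left)

lemma form_deriv_in_dual_space: "u \<in> dual_space \<Longrightarrow> form_deriv u \<in> dual_space"
  unfolding dual_space_def form_deriv_def mem_Collect_eq Vector_Spaces.linear_iff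
  by (simp add: pderiv_add pderiv_smult)

definition form_matrix_mult :: "complex poly ^ 2 ^ 2 \<Rightarrow> form ^ 2 \<Rightarrow> form ^ 2" where
  "form_matrix_mult M U = (\<chi> i. \<Sum>j\<in>UNIV. form_mult (M $ i $ j) (U $ j))"

definition form_vec_deriv :: "form ^ 2 \<Rightarrow> form ^ 2" where
  "form_vec_deriv U = (\<chi> i. form_deriv (U $ i))"

definition monic_poly_seq :: "(nat \<Rightarrow> complex poly) \<Rightarrow> bool" where
  "monic_poly_seq P \<longleftrightarrow> (\<forall>n. degree (P n) = n \<and> lead_coeff (P n) = 1)"

definition dual_sequence :: "(nat \<Rightarrow> complex poly) \<Rightarrow> (nat \<Rightarrow> form) \<Rightarrow> bool" where
  "dual_sequence P u \<longleftrightarrow>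
     (\<forall>n. u n \<in> dual_space) \<and> (\<forall>n m. u n (P m) = (if n = m then 1 else 0))"

text \<open>The values \<open>\<alpha> 0\<close> and \<open>\<gamma> 0\<close> are junk: the coefficients
  \<open>\<alpha>\<close> and \<open>\<gamma>\<close> are indexed from 1.\<close>

definition two_orthogonal_with ::
  "(nat \<Rightarrow> complex) \<Rightarrow> (nat \<Rightarrow> complex) \<Rightarrow> (nat \<Rightarrow> complex) \<Rightarrow> (nat \<Rightarrow> complex poly) \<Rightarrow> bool" where
  "two_orthogonal_with \<beta> \<alpha> \<gamma> P \<longleftrightarrow>
     monic_poly_seq P \<and>
     (\<forall>n. \<gamma> (n + 1) \<noteq> 0) \<and>
     P 0 = 1 \<and>
     P 1 = [:- \<beta> 0, 1:] \<and>
     P 2 = [:- \<beta> 1, 1:] * P 1 - [:\<alpha> 1:] \<and>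
     (\<forall>n. P (n + 3) = [:- \<beta> (n + 2), 1:] * P (n + 2)
            - smult (\<alpha> (n + 2)) (P (n + 1)) - smult (\<gamma> (n + 1)) (P n))"

definition two_orthogonal :: "(nat \<Rightarrow> complex poly) \<Rightarrow> bool" where
  "two_orthogonal P \<longleftrightarrow> (\<exists>\<beta> \<alpha> \<gamma>. two_orthogonal_with \<beta> \<alpha> \<gamma> P)"

definition deriv_seq :: "(nat \<Rightarrow> complex poly) \<Rightarrow> nat \<Rightarrow> complex poly" where
  "deriv_seq P n = smult (1 / of_nat (n + 1)) (pderiv (P (n + 1)))"

definition two_classical_Hahn :: "(nat \<Rightarrow> complex poly) \<Rightarrow> bool" where
  "two_classical_Hahn P \<longleftrightarrow> two_orthogonal P \<and> two_orthogonal (deriv_seq P)"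

definition diff_op ::
  "complex poly \<Rightarrow> complex poly \<Rightarrow> complex poly \<Rightarrow> complex poly \<Rightarrow> complex poly" where
  "diff_op a0 a1 a2 p = a0 * p + a1 * pderiv p + smult (1 / 2) a2 * pderiv (pderiv p)"

text \<open>The condition at \<open>n = 0\<close> is not affected by \<open>degree 0 = 0\<close>, since \<open>J(x)\<close>
  is required to be a nonzero constant.\<close>

definition lowering_op_order_one ::
  "complex poly \<Rightarrow> complex poly \<Rightarrow> complex poly \<Rightarrow> bool" where
  "lowering_op_order_one a0 a1 a2 \<longleftrightarrow>
     degree a0 = 0 \<and> degree a1 \<le> 1 \<and> degree a2 \<le> 2 \<and>
     diff_op a0 a1 a2 1 = 0 \<and>
     diff_op a0 a1 a2 [:0, 1:] = [:coeff a1 0:] \<and> coeff a1 0 \<noteq> 0 \<and>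
     (\<forall>n. degree (diff_op a0 a1 a2 ([:0, 1:] ^ (n + 1))) = n)"

end

theory Submission imports Defs begin

text \<open>
  Write \<open>J = a D + (a2/2) D^2\<close> with \<open>a2 = b0 + b1 x\<close>. By duality \<open>J\<close> raises the index of the
  dual sequence, \<open>u n \<circ> J = L (n + 1) u (n + 1)\<close>, and the recurrence says how \<open>x\<close> acts on it.
  Combining these with \<open>J (x p) = x J p + a p + a2 p'\<close> gives the differential equation.

  For the classical character, applying \<open>J\<close> to the recurrence writes \<open>a2 P'(n)\<close> in terms of
  \<open>P n, \<dots>, P (n - 3)\<close>, with some coefficient \<open>\<kappa> n\<close> at \<open>P (n - 3)\<close>. Applying \<open>J\<close> again shows that the
  numbers \<open>\<kappa> n\<close>, \<open>n \<ge> 3\<close>, vanish together, and comparing two expansions of \<open>a2 P 5\<close> gives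
  \<open>\<kappa> 6 \<kappa> 3 = 0\<close>; so all of them vanish. Differentiating the relation then expresses \<open>P n\<close>
  by \<open>P'(n + 1), P'(n), P'(n - 1)\<close>. Inserted into the differentiated recurrence, this yields a
  recurrence for the derivatives whose last coefficient is \<open>\<gamma> (n + 1)\<close> times \<open>n / (n + 2)\<close>.
\<close>

section \<open>Linear forms and their determination by a monic basis\<close>

lemma dual_space_iff:
  "u \<in> dual_space \<longleftrightarrow> (\<forall>p q. u (p + q) = u p + u q) \<and> (\<forall>c p. u (smult c p) = c * u p)"
proof -
  have "vector_space (smult :: complex \<Rightarrow> _)" "vector_space ((*) :: complex \<Rightarrow> _)"
    by unfold_locales (simp_all add: algebra_simps smult_add_left smult_add_right)
  then show ?thesis
    by (simp add: dual_space_def Vector_Spaces.linear_iff)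
qed

lemma dual_space_simps:
  assumes "u \<in> dual_space"
  shows "u (p + q) = u p + u q" "u (p - q) = u p - u q" "u (- p) = - u p"
    "u (smult c p) = c * u p" "u 0 = 0"
proof -
  have add: "u (p + q) = u p + u q" and smult: "u (smult c p) = c * u p" for p q c
    using assms by (auto simp: dual_space_iff)
  show "u (p + q) = u p + u q" "u (smult c p) = c * u p"
    by (fact add smult)+
  show "u 0 = 0"
    using smult[of 0 0] by simp
  show minus: "u (- p) = - u p"
    using smult[of "-1" p] by simp
  show "u (p - q) = u p - u q"
    using add[of p "- q"] smult[of "-1" q] by simp
qed

text \<open>Subtracting the multiple of \<open>P (degree p)\<close> with the same leading
  coefficient leaves zero or a polynomial of smaller degree.\<close>

lemma dual_space_eqI:
  assumes P: "monic_poly_seq P" and u: "u \<in> dual_space" and v: "v \<in> dual_space"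
    and eq: "\<And>n. u (P n) = v (P n)"
  shows "u p = v p"
proof (induction "degree p" arbitrary: p rule: less_induct)
  case less
  define q where "q = p - smult (lead_coeff p) (P (degree p))"
  have degP: "degree (P n) = n" "coeff (P n) n = 1" for n
    using P unfolding monic_poly_seq_def by metis+
  have "u q = v q"
  proof (cases "q = 0")
    case True
    then show ?thesis by (simp add: dual_space_simps(5) u v)
  next
    case False
    have "degree q \<le> degree p"
      unfolding q_def using degP by (intro degree_diff_le) auto
    moreover have "degree q \<noteq> degree p"
      using False by (metis q_def degP(2) coeff_diff coeff_smult diff_self leading_coeff_0_iff mult.right_neutral)
    ultimately show ?thesis
      using less by simp
  qed
  moreover have "p = q + smult (lead_coeff p) (P (degree p))"
    by (simp add: q_def)
  ultimately show ?case
    by (metis dual_space_simps(1,4) eq u v)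
qed

text \<open>The images of 1 and \<open>x\<close> fix \<open>a0\<close> and \<open>a1\<close>; since
  the image of \<open>x^2\<close> has degree one, \<open>a2\<close> has no quadratic term.\<close>

lemma lowering_op_order_one_coeffs:
  assumes "lowering_op_order_one a0 a1 a2"
  shows "a0 = 0" "a1 = [:coeff a1 0:]" "a2 = [:coeff a2 0, coeff a2 1:]"
proof -
  have "diff_op a0 a1 a2 1 = 0" and x: "diff_op a0 a1 a2 [:0, 1:] = [:coeff a1 0:]"
    and deg: "degree a2 \<le> 2" and "degree (diff_op a0 a1 a2 ([:0, 1:] ^ (1 + 1))) = 1"
    using assms unfolding lowering_op_order_one_def by blast+
  then show a0: "a0 = 0"
    by (simp add: diff_op_def)
  with x show a1: "a1 = [:coeff a1 0:]"
    by (simp add: diff_op_def pderiv_pCons)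
  have "diff_op a0 a1 a2 ([:0, 1:] ^ (1 + 1)) = smult (2 * coeff a1 0) [:0, 1:] + a2"
    by (subst a1) (simp add: a0 diff_op_def pderiv_pCons power2_eq_square poly_eq_iff)
  with \<open>degree (diff_op a0 a1 a2 ([:0, 1:] ^ (1 + 1))) = 1\<close>
  have "coeff (smult (2 * coeff a1 0) [:0, 1:] + a2) 2 = 0"
    by (intro coeff_eq_0) simp
  then have "coeff a2 2 = 0"
    by (simp add: numeral_2_eq_2)
  moreover have "coeff a2 n = 0" if "n > 2" for n
    using deg that by (intro coeff_eq_0) simp
  ultimately have "coeff a2 n = 0" if "n > 1" for n
    using that by (cases "n = 2") auto
  then show "a2 = [:coeff a2 0, coeff a2 1:]"
    by (auto simp: poly_eq_iff coeff_pCons split: nat.splits)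
qed

section \<open>Action of \<open>J\<close> and of multiplication by \<open>x\<close> on the sequence
  and on its dual\<close>

locale two_orthogonal_lowering =
  fixes P :: "nat \<Rightarrow> complex poly" and u :: "nat \<Rightarrow> form"
    and \<beta> \<alpha> \<gamma> L :: "nat \<Rightarrow> complex" and a b0 b1 :: complex
    and J :: "complex poly \<Rightarrow> complex poly"
  assumes J_def: "J = (\<lambda>p. smult a (pderiv p) + smult (1 / 2) ([:b0, b1:] * pderiv (pderiv p)))"
    and orth: "two_orthogonal_with \<beta> \<alpha> \<gamma> P"
    and dual: "dual_sequence P u"
    and L_eq: "L n = of_nat n * a + of_nat n * (of_nat n - 1) / 2 * b1"
    and L_nonzero: "n > 0 \<Longrightarrow> L n \<noteq> 0"
    and J_P_Suc: "J (P (Suc n)) = smult (L (Suc n)) (P n)"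
begin

lemma monic: "monic_poly_seq P"
  using orth by (simp add: two_orthogonal_with_def)

lemma u_dual_space: "u n \<in> dual_space"
  using dual by (simp add: dual_sequence_def)

lemmas u_simps = dual_space_simps[OF u_dual_space]

lemma u_P: "u n (P m) = (if n = m then 1 else 0)"
  using dual by (simp add: dual_sequence_def)

lemma gamma_nonzero: "n > 0 \<Longrightarrow> \<gamma> n \<noteq> 0"
  using orth by (cases n) (auto simp: two_orthogonal_with_def)

text \<open>Padding with zeros makes the relations below uniform in the index: \<open>R (n + 3)\<close> is
  \<open>P n\<close>, with \<open>P (-1)\<close>, \<open>P (-2)\<close> and \<open>P (-3)\<close> read as zero.\<close>

definition R :: "nat \<Rightarrow> complex poly" where
  "R n = (if n < 3 then 0 else P (n - 3))"

text \<open>Covers the initial conditions too: for \<open>n < 2\<close> the junk values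
  \<open>\<alpha> 0\<close> and \<open>\<gamma> 0\<close> only multiply zero entries of
  \<open>R\<close>.\<close>

lemma R_rec:
  "R (n + 4) = [:- \<beta> n, 1:] * R (n + 3) - smult (\<alpha> n) (R (n + 2)) - smult (\<gamma> (n - 1)) (R (n + 1))"
proof -
  consider "n = 0" | "n = 1" | k where "n = k + 2"
    by (metis One_nat_def Suc_1 add_2_eq_Suc' not0_implies_Suc)
  then show ?thesis
  proof cases
    case (3 k)
    then show ?thesis
      using orth by (simp add: R_def two_orthogonal_with_def numeral_3_eq_3 eval_nat_numeral)
  qed (use orth in \<open>simp_all add: R_def two_orthogonal_with_def one_pCons eval_nat_numeral\<close>)
qed

lemma u_R: "u n (R m) = (if m = n + 3 then 1 else 0)"
  by (auto simp: R_def u_P u_simps)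

lemma J_add: "J (p + q) = J p + J q"
  and J_smult: "J (smult c p) = smult c (J p)"
  by (simp_all add: J_def pderiv_add pderiv_smult algebra_simps smult_add_right)

lemma J_diff: "J (p - q) = J p - J q"
  using J_add[of p "smult (-1) q"] J_smult[of "-1" q] by simp

lemma J_mult_X: "J ([:c, 1:] * p) = [:c, 1:] * J p + smult a p + [:b0, b1:] * pderiv p"
  unfolding J_def pderiv_mult pderiv_add
  by (simp add: pderiv_pCons pderiv_mult pderiv_add algebra_simps smult_add_right poly_eq_poly_eq_iff[symmetric] fun_eq_iff)

lemma J_R: "J (R (n + 1)) = smult (L (n - 2)) (R n)"
proof -
  have "J 0 = 0" "J 1 = 0"
    by (simp_all add: J_def)
  moreover have "P 0 = 1"
    using orth by (simp add: two_orthogonal_with_def)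
  moreover have "n - 2 = Suc (n - 3)" if "n \<ge> 3"
    using that by simp
  ultimately show ?thesis
    using J_P_Suc[of "n - 3"] by (auto simp: R_def not_less)
qed

text \<open>Both sides are forms in \<open>p\<close>, so it suffices to test them on the basis
  \<open>P m\<close>.\<close>

lemma u_J: "u n (J p) = L (n + 1) * u (n + 1) p"
proof -
  have "(\<lambda>p. u n (J p)) \<in> dual_space" "(\<lambda>p. L (n + 1) * u (n + 1) p) \<in> dual_space"
    by (simp_all add: dual_space_iff u_simps J_add J_smult algebra_simps)
  then show ?thesis
  proof (rule dual_space_eqI[OF monic])
    show "u n (J (P m)) = L (n + 1) * u (n + 1) (P m)" for m
      using J_R[of "m + 2"] u_R[of n "m + 2"] by (auto simp: R_def u_P u_simps)
  qed
qed

lemma u_mult_X: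
  "u n ([:- \<beta> n, 1:] * p) =
     (if n = 0 then 0 else u (n - 1) p) + \<alpha> (n + 1) * u (n + 1) p + \<gamma> (n + 1) * u (n + 2) p"
proof -
  have "(\<lambda>p. u n ([:- \<beta> n, 1:] * p)) \<in> dual_space"
    "(\<lambda>p. (if n = 0 then 0 else u (n - 1) p) + \<alpha> (n + 1) * u (n + 1) p + \<gamma> (n + 1) * u (n + 2) p)
       \<in> dual_space"
    by (simp_all only: dual_space_iff distrib_left mult_smult_right u_simps) (simp_all add: algebra_simps)
  then show ?thesis
  proof (rule dual_space_eqI[OF monic])
    fix m
    \<comment> \<open>The recurrence at \<open>m\<close>, recentred at \<open>\<beta> n\<close>: at
      \<open>m = n\<close> the coefficient of \<open>P m\<close> vanishes, and for other
      \<open>m\<close> the form \<open>u n\<close> kills \<open>P m\<close>.\<close>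
    have "[:- \<beta> n, 1:] * P m =
      R (m + 4) + smult (\<beta> m - \<beta> n) (R (m + 3)) + smult (\<alpha> m) (R (m + 2)) + smult (\<gamma> (m - 1)) (R (m + 1))"
      unfolding R_rec by (simp add: R_def smult_add_left[symmetric] smult_diff_left algebra_simps)
    then have "u n ([:- \<beta> n, 1:] * P m) = u n (R (m + 4) + smult (\<beta> m - \<beta> n) (R (m + 3)) +
        smult (\<alpha> m) (R (m + 2)) + smult (\<gamma> (m - 1)) (R (m + 1)))"
      by simp
    also have "\<dots> = (if n = 0 then 0 else u (n - 1) (P m)) +
        \<alpha> (n + 1) * u (n + 1) (P m) + \<gamma> (n + 1) * u (n + 2) (P m)"
      unfolding u_simps u_R u_P by auto
    finally show "u n ([:- \<beta> n, 1:] * P m) = \<dots>" .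
  qed
qed

text \<open>Computes \<open>u n (J (x p'))\<close> in two ways, using \<open>2 J p = 2 a p' + a2 p''\<close>.\<close>

lemma u_pderiv:
  "2 * L (n + 1) * u (n + 1) p =
     (a - L n) * u n (pderiv p) + L (n + 1) * u (n + 1) ([:- \<beta> n, 1:] * pderiv p)
       - \<alpha> (n + 1) * L (n + 2) * u (n + 2) (pderiv p)
       - \<gamma> (n + 1) * L (n + 3) * u (n + 3) (pderiv p)"
proof -
  have "2 * L (n + 1) * u (n + 1) p = u n (smult 2 (J p))"
    by (simp add: u_simps u_J)
  also have "smult 2 (J p) = smult a (pderiv p) +
      (J ([:- \<beta> n, 1:] * pderiv p) - [:- \<beta> n, 1:] * J (pderiv p))"
    unfolding J_mult_X using smult_add_left[of a a "pderiv p"]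
    by (simp add: J_def smult_add_right del: mult_pCons_left)
  also have "u n \<dots> = a * u n (pderiv p) + (L (n + 1) * u (n + 1) ([:- \<beta> n, 1:] * pderiv p) -
      ((if n = 0 then 0 else u (n - 1) (J (pderiv p))) +
        \<alpha> (n + 1) * u (n + 1) (J (pderiv p)) + \<gamma> (n + 1) * u (n + 2) (J (pderiv p))))"
    by (simp only: u_simps u_J[of _ "[:- \<beta> n, 1:] * _"] u_mult_X)
  \<comment> \<open>The case \<open>n = 0\<close> is absorbed because
    \<open>L 0 = 0\<close>.\<close>
  also have "(if n = 0 then 0 else u (n - 1) (J (pderiv p))) = L n * u n (pderiv p)"
    using L_eq[of 0] by (simp add: u_J)
  finally show ?thesis
    by (simp add: u_J algebra_simps eval_nat_numeral)
qed

section \<open>Expansion of \<open>a2\<close> times a derivative in the sequence\<close>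

definition \<sigma> :: "nat \<Rightarrow> complex" where
  "\<sigma> n = L n * (\<beta> n - \<beta> (n - 1))"

definition \<tau> :: "nat \<Rightarrow> complex" where
  "\<tau> n = \<alpha> n * L (n - 1) - \<alpha> (n - 1) * L n"

text \<open>\<open>\<sigma> n\<close>, \<open>\<tau> n\<close> and \<open>\<kappa> n\<close> serve
  as the coefficients of \<open>P (n - 1)\<close>, \<open>P (n - 2)\<close> and
  \<open>P (n - 3)\<close>. Where subtraction truncates, they multiply zero entries of
  \<open>R\<close>.\<close>

definition \<kappa> :: "nat \<Rightarrow> complex" where
  "\<kappa> n = \<gamma> (n - 1) * L (n - 2) - \<gamma> (n - 2) * L n"

text \<open>Obtained by applying \<open>J\<close> to the recurrence.\<close>

lemma a2_pderiv_R:
  "[:b0, b1:] * pderiv (R (n + 3)) =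
     smult (of_nat n * b1) (R (n + 3)) + smult (\<sigma> n) (R (n + 2)) +
     smult (\<tau> n) (R (n + 1)) + smult (\<kappa> n) (R n)"
proof -
  have J: "J (R (n + 4)) = smult (L (n + 1)) (R (n + 3))" "J (R (n + 3)) = smult (L n) (R (n + 2))"
    "J (R (n + 2)) = smult (L (n - 1)) (R (n + 1))"
    using J_R[of "n + 3"] J_R[of "n + 2"] J_R[of "n + 1"] by (simp_all add: eval_nat_numeral)
  have "smult (L (n + 1)) (R (n + 3)) =
      [:- \<beta> n, 1:] * smult (L n) (R (n + 2)) + smult a (R (n + 3)) + [:b0, b1:] * pderiv (R (n + 3))
      - smult (\<alpha> n) (smult (L (n - 1)) (R (n + 1))) - smult (\<gamma> (n - 1)) (smult (L (n - 2)) (R n))"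
    using J(1) unfolding R_rec J_diff J_mult_X J_smult J(2,3) J_R by metis
  \<comment> \<open>The recurrence one index lower expands this product; at \<open>n = 0\<close>
    both sides vanish with \<open>L 0\<close>.\<close>
  moreover have "[:- \<beta> n, 1:] * smult (L n) (R (n + 2)) =
      smult (L n) (R (n + 3) + smult (\<beta> (n - 1) - \<beta> n) (R (n + 2)) + smult (\<alpha> (n - 1)) (R (n + 1))
        + smult (\<gamma> (n - 2)) (R n))"
  proof (cases n)
    case 0
    then show ?thesis by (simp add: L_eq)
  next
    case (Suc m)
    then show ?thesis
      using R_rec[of m] by (simp add: eval_nat_numeral smult_diff_left algebra_simps)
  qed
  moreover have "L (n + 1) = L n + a + of_nat n * b1"
    by (simp add: L_eq field_simps)
  ultimately show ?thesis
    by (simp add: \<sigma>_def \<tau>_def \<kappa>_def smult_diff_left smult_diff_right smult_add_left smult_add_right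
        algebra_simps del: mult_pCons_left)
qed

lemma u_a2_pderiv_R:
  "u k ([:b0, b1:] * pderiv (R (n + 3))) =
     (if n = k then of_nat n * b1 else if n = k + 1 then \<sigma> n else if n = k + 2 then \<tau> n
      else if n = k + 3 then \<kappa> n else 0)"
  unfolding a2_pderiv_R u_simps u_R by auto

text \<open>Obtained by differentiating \<open>a2_pderiv_R\<close>.\<close>

lemma R_eq_pderiv:
  "smult (2 * L n) (R (n + 2)) =
     smult (2 * a + (of_nat n - 1) * b1) (pderiv (R (n + 3))) + smult (\<sigma> n) (pderiv (R (n + 2))) +
     smult (\<tau> n) (pderiv (R (n + 1))) + smult (\<kappa> n) (pderiv (R n))"
proof -
  have "smult b1 (pderiv (R (n + 3))) + [:b0, b1:] * pderiv (pderiv (R (n + 3))) =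
      pderiv ([:b0, b1:] * pderiv (R (n + 3)))"
    by (subst pderiv_mult) (simp add: pderiv_pCons)
  also have "\<dots> = smult (of_nat n * b1) (pderiv (R (n + 3))) + smult (\<sigma> n) (pderiv (R (n + 2))) +
     smult (\<tau> n) (pderiv (R (n + 1))) + smult (\<kappa> n) (pderiv (R n))"
    unfolding a2_pderiv_R by (simp add: pderiv_add pderiv_smult)
  finally have "[:b0, b1:] * pderiv (pderiv (R (n + 3))) = \<dots> - smult b1 (pderiv (R (n + 3)))"
    by (simp add: algebra_simps)
  moreover have "smult (2 * L n) (R (n + 2)) = smult 2 (J (R (n + 3)))"
    using J_R[of "n + 2"] by (simp add: eval_nat_numeral)
  moreover have "smult 2 (J (R (n + 3))) =
      smult (2 * a) (pderiv (R (n + 3))) + [:b0, b1:] * pderiv (pderiv (R (n + 3)))"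
    by (simp add: J_def smult_add_right)
  ultimately show ?thesis
    by (simp add: smult_add_left smult_diff_left algebra_simps)
qed

section \<open>Vanishing of the lowest coefficient\<close>

lemma J_a2_pderiv:
  "J ([:b0, b1:] * pderiv p) = [:b0, b1:] * pderiv (J p) + smult b1 (J p)"
proof -
  have pderiv_a2: "pderiv ([:b0, b1:] * q) = [:b0, b1:] * pderiv q + smult b1 q" for q
    by (subst pderiv_mult) (simp add: pderiv_pCons)
  show ?thesis
    unfolding J_def pderiv_a2 pderiv_add pderiv_smult smult_add_right distrib_left mult_smult_right
      smult_smult
    by (simp only: ac_simps)
qed

text \<open>Compares the coefficient of \<open>P k\<close> in two expansions of \<open>J\<close>
  applied to \<open>a2\<close> times the derivative of \<open>P (k + 4)\<close>. By
  \<open>J_a2_pderiv\<close> the two operators commute up to \<open>b1\<close> times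
  \<open>J\<close>, which only adds a multiple of \<open>P (k + 3)\<close>.\<close>

lemma kappa_rec: "L (k + 4) * \<kappa> (k + 3) = L (k + 1) * \<kappa> (k + 4)"
proof -
  have J: "J (R (k + 7)) = smult (L (k + 4)) (R (k + 6))"
    using J_R[of "k + 6"] by (simp add: eval_nat_numeral)
  have "L (k + 1) * \<kappa> (k + 4) = u k (J ([:b0, b1:] * pderiv (R (k + 7))))"
    unfolding u_J using u_a2_pderiv_R[of "k + 1" "k + 4"] by (simp add: eval_nat_numeral)
  also have "\<dots> = L (k + 4) * u k ([:b0, b1:] * pderiv (R (k + 6)))"
    unfolding J_a2_pderiv J pderiv_smult mult_smult_right u_simps u_R by simp
  also have "\<dots> = L (k + 4) * \<kappa> (k + 3)"
    using u_a2_pderiv_R[of k "k + 3"] by (simp add: eval_nat_numeral)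
  finally show ?thesis by simp
qed

text \<open>Multiplying \<open>R_eq_pderiv\<close> by \<open>a2\<close>, the lowest term on the right is a multiple of \<open>P 0\<close>
  with factor \<open>\<kappa> 6 * \<kappa> 3\<close>, while the left-hand side is a combination of \<open>P 3, \<dots>, P 6\<close>.\<close>

lemma kappa_6_3: "\<kappa> 6 * \<kappa> 3 = 0"
proof -
  \<comment> \<open>Centring \<open>a2\<close> at \<open>\<beta> 0\<close> makes
    \<open>u_mult_X\<close> applicable with \<open>n = 0\<close>; the resulting forms
    \<open>u 0\<close>, \<open>u 1\<close>, \<open>u 2\<close> all kill \<open>P 5\<close>.\<close>
  have "[:b0, b1:] * R 8 = smult b1 ([:- \<beta> 0, 1:] * R 8) + smult (b0 + b1 * \<beta> 0) (R 8)"
    by (simp add: smult_add_left smult_diff_right algebra_simps)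
  then have "u 0 ([:b0, b1:] * R 8) = 0"
    by (simp only: u_simps u_mult_X u_R) simp
  then have "0 = u 0 ([:b0, b1:] * smult (2 * L 6) (R 8))"
    by (simp only: mult_smult_right u_simps mult_zero_right)
  also have "smult (2 * L 6) (R 8) = smult (2 * a + 5 * b1) (pderiv (R 9)) + smult (\<sigma> 6) (pderiv (R 8)) +
     smult (\<tau> 6) (pderiv (R 7)) + smult (\<kappa> 6) (pderiv (R 6))"
    using R_eq_pderiv[of 6] by simp
  also have "u 0 ([:b0, b1:] * \<dots>) = \<kappa> 6 * \<kappa> 3"
    using u_a2_pderiv_R[of 0 6] u_a2_pderiv_R[of 0 5] u_a2_pderiv_R[of 0 4] u_a2_pderiv_R[of 0 3]
    by (simp only: distrib_left mult_smult_right u_simps) simp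
  finally show ?thesis by simp
qed

lemma kappa_eq_0: "\<kappa> (k + 3) = 0"
proof -
  have step: "\<kappa> (k + 4) = 0 \<longleftrightarrow> \<kappa> (k + 3) = 0" for k
    using kappa_rec[of k] L_nonzero[of "k + 4"] L_nonzero[of "k + 1"] by auto
  have "\<kappa> (k + 3) = 0 \<longleftrightarrow> \<kappa> 3 = 0" for k
  proof (induction k)
    case (Suc k)
    then show ?case
      using step[of k] by (simp add: eval_nat_numeral)
  qed simp
  from this[of k] this[of 3] kappa_6_3 show ?thesis by simp
qed

section \<open>Recurrence of the derivative sequence\<close>

lemma deriv_seq_eq: "deriv_seq P n = smult (1 / of_nat (n + 1)) (pderiv (R (n + 4)))"
  by (simp add: deriv_seq_def R_def numeral_eq_Suc)

lemma pderiv_R: "pderiv (R (n + 3)) = smult (of_nat n) (deriv_seq P (n - 1))"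
  using orth by (cases n) (auto simp: deriv_seq_eq R_def numeral_eq_Suc two_orthogonal_with_def simp del: of_nat_Suc)

lemma monic_deriv_seq: "monic_poly_seq (deriv_seq P)"
proof -
  have "degree (P n) = n" "coeff (P n) n = 1" for n
    using monic unfolding monic_poly_seq_def by metis+
  then show ?thesis
    by (simp add: monic_poly_seq_def deriv_seq_def degree_pderiv coeff_pderiv divide_simps flip: of_nat_Suc)
qed

text \<open>\<open>R_eq_pderiv\<close> without its \<open>\<kappa>\<close> term replaces
  \<open>P (n + 1)\<close> in the differentiated recurrence.\<close>

lemma deriv_seq_rec:
  fixes n :: nat
  defines "s \<equiv> \<sigma> (n + 2) / (2 * L (n + 2))" and "t \<equiv> \<tau> (n + 2) / (2 * L (n + 2))"
  shows "deriv_seq P (n + 1) = [:- (\<beta> (n + 1) - s), 1:] * deriv_seq P n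
     - smult ((\<alpha> (n + 1) - t) * of_nat n / of_nat (n + 1)) (deriv_seq P (n - 1))
     - smult (\<gamma> n * of_nat (n - 1) / of_nat (n + 1)) (deriv_seq P (n - 2))"
proof -
  let ?Q = "deriv_seq P"
  have R': "pderiv (R (n + 5)) = smult (of_nat (n + 2)) (?Q (n + 1))"
    "pderiv (R (n + 4)) = smult (of_nat (n + 1)) (?Q n)"
    "pderiv (R (n + 3)) = smult (of_nat n) (?Q (n - 1))"
    "pderiv (R (n + 2)) = smult (of_nat (n - 1)) (?Q (n - 2))"
    using pderiv_R[of "n + 2"] pderiv_R[of "n + 1"] pderiv_R[of n] pderiv_R[of "n - 1"]
    by (simp_all add: numeral_eq_Suc) (cases n; simp add: R_def numeral_eq_Suc)
  \<comment> \<open>\<open>kappa_eq_0\<close> does not reach \<open>\<kappa> 2\<close>, but at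
    \<open>n = 0\<close> the factor \<open>R 2\<close> is zero.\<close>
  have "\<kappa> (n + 2) = 0 \<or> pderiv (R (n + 2)) = 0"
    using kappa_eq_0[of "n - 1"] by (cases n) (auto simp: R_def numeral_eq_Suc)
  then have kappa: "smult (\<kappa> (n + 2)) (pderiv (R (n + 2))) = 0"
    by auto
  have "2 * L (n + 2) = (2 * a + (of_nat (n + 2) - 1) * b1) * of_nat (n + 2)"
    unfolding L_eq by (simp add: field_simps del: of_nat_add)
  moreover have nz: "of_nat (n + 2) \<noteq> (0 :: complex)"
    by (simp only: of_nat_eq_0_iff)
  ultimately have L: "L (n + 2) \<noteq> 0" "2 * a + (of_nat (n + 2) - 1) * b1 = 2 * L (n + 2) / of_nat (n + 2)"
    using L_nonzero[of "n + 2"] by (simp_all add: nonzero_eq_divide_eq del: of_nat_add)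
  have "R (n + 4) = smult (1 / (2 * L (n + 2))) (smult (2 * L (n + 2)) (R (n + 4)))"
    using L by simp
  also have "smult (2 * L (n + 2)) (R (n + 4)) = smult (2 * L (n + 2) / of_nat (n + 2)) (pderiv (R (n + 5)))
      + smult (\<sigma> (n + 2)) (pderiv (R (n + 4))) + smult (\<tau> (n + 2)) (pderiv (R (n + 3)))"
    using R_eq_pderiv[of "n + 2"] kappa unfolding L(2) by (simp add: numeral_eq_Suc)
  also have "smult (1 / (2 * L (n + 2))) \<dots> = smult (1 / of_nat (n + 2)) (pderiv (R (n + 5)))
      + smult s (pderiv (R (n + 4))) + smult t (pderiv (R (n + 3)))"
    using L(1) by (simp add: s_def t_def smult_add_right)
  finally have R4: "R (n + 4) = ?Q (n + 1) + smult (s * of_nat (n + 1)) (?Q n) + smult (t * of_nat n) (?Q (n - 1))"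
    using nz unfolding R' by (simp del: of_nat_add)
  have "pderiv (R (n + 5)) = R (n + 4) + [:- \<beta> (n + 1), 1:] * pderiv (R (n + 4))
      - smult (\<alpha> (n + 1)) (pderiv (R (n + 3))) - smult (\<gamma> n) (pderiv (R (n + 2)))"
  proof -
    have "R (n + 5) = [:- \<beta> (n + 1), 1:] * R (n + 4) - smult (\<alpha> (n + 1)) (R (n + 3)) - smult (\<gamma> n) (R (n + 2))"
      using R_rec[of "n + 1"] by (simp add: numeral_eq_Suc)
    also have "pderiv \<dots> = R (n + 4) + [:- \<beta> (n + 1), 1:] * pderiv (R (n + 4))
        - smult (\<alpha> (n + 1)) (pderiv (R (n + 3))) - smult (\<gamma> n) (pderiv (R (n + 2)))"
      by (simp only: pderiv_diff pderiv_smult pderiv_mult) (simp add: pderiv_pCons)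
    finally show ?thesis .
  qed
  moreover have smult_2: "smult 2 p = p + p" for p :: "complex poly"
    using smult_add_left[of 1 1 p] by simp
  moreover have x: "[:- (\<beta> (n + 1) - s), 1:] * ?Q n = [:- \<beta> (n + 1), 1:] * ?Q n + smult s (?Q n)"
    by (simp add: smult_diff_left)
  \<comment> \<open>\<open>R (n + 4)\<close> contributes one copy of \<open>?Q (n + 1)\<close>,
    which lowers the factor \<open>n + 2\<close> on the left to \<open>n + 1\<close>.\<close>
  ultimately have "smult (of_nat (n + 1)) (?Q (n + 1)) =
      smult (of_nat (n + 1)) ([:- (\<beta> (n + 1) - s), 1:] * ?Q n) - smult ((\<alpha> (n + 1) - t) * of_nat n) (?Q (n - 1))
      - smult (\<gamma> n * of_nat (n - 1)) (?Q (n - 2))"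
    unfolding R' unfolding R4 x
    by (simp add: smult_2 smult_add_left smult_diff_left smult_diff_right smult_add_right algebra_simps
        del: mult_pCons_left)
  then have "smult (1 / of_nat (n + 1)) (smult (of_nat (n + 1)) (?Q (n + 1))) =
      smult (1 / of_nat (n + 1)) (smult (of_nat (n + 1)) ([:- (\<beta> (n + 1) - s), 1:] * ?Q n)
      - smult ((\<alpha> (n + 1) - t) * of_nat n) (?Q (n - 1)) - smult (\<gamma> n * of_nat (n - 1)) (?Q (n - 2)))"
    by (rule arg_cong)
  then show ?thesis
    by (simp only: smult_diff_right smult_smult) (simp del: of_nat_Suc)
qed

theorem two_classical_Hahn: "two_classical_Hahn P"
proof -
  define \<beta>' where "\<beta>' n = \<beta> (n + 1) - \<sigma> (n + 2) / (2 * L (n + 2))" for n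
  define \<alpha>' where "\<alpha>' n = (\<alpha> (n + 1) - \<tau> (n + 2) / (2 * L (n + 2))) * of_nat n / of_nat (n + 1)" for n
  \<comment> \<open>Shifted by one against \<open>deriv_seq_rec\<close>, so that
    \<open>\<gamma>' (n + 1)\<close> goes with \<open>deriv_seq P n\<close>; the factor
    \<open>n / (n + 2)\<close> vanishes only at index 0.\<close>
  define \<gamma>' where "\<gamma>' n = \<gamma> (n + 1) * of_nat n / of_nat (n + 2)" for n
  note rec = deriv_seq_rec[folded \<beta>'_def \<alpha>'_def]
  have Q0: "deriv_seq P 0 = 1"
    using orth by (simp add: deriv_seq_def two_orthogonal_with_def pderiv_pCons one_pCons)
  have Q1: "deriv_seq P 1 = [:- \<beta>' 0, 1:]"
    using rec[of 0] by (simp add: Q0 \<alpha>'_def)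
  have Q2: "deriv_seq P 2 = [:- \<beta>' 1, 1:] * deriv_seq P 1 - [:\<alpha>' 1:]"
    using rec[of 1] by (simp add: Q0 numeral_2_eq_2 one_pCons)
  have Q3: "deriv_seq P (n + 3) = [:- \<beta>' (n + 2), 1:] * deriv_seq P (n + 2)
      - smult (\<alpha>' (n + 2)) (deriv_seq P (n + 1)) - smult (\<gamma>' (n + 1)) (deriv_seq P n)" for n
    using rec[of "n + 2"] by (simp add: \<gamma>'_def numeral_eq_Suc)
  have "\<gamma>' (n + 1) \<noteq> 0" for n
    using gamma_nonzero[of "n + 2"] by (simp add: \<gamma>'_def flip: of_nat_Suc)
  then have "two_orthogonal_with \<beta>' \<alpha>' \<gamma>' (deriv_seq P)"
    using monic_deriv_seq Q0 Q1 Q2 Q3 by (simp add: two_orthogonal_with_def)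
  with orth show ?thesis
    by (auto simp: two_classical_Hahn_def two_orthogonal_def)
qed

end

section \<open>The matrix equation for the first two dual forms\<close>

theorem proposition5p1:
  fixes P :: "nat \<Rightarrow> complex poly"
    and \<beta> \<alpha> \<gamma> lam :: "nat \<Rightarrow> complex"
    and u :: "nat \<Rightarrow> form"
    and a0 a1 a2 :: "complex poly"
    and E1 A0 B1 F1 E2 A1 \<phi>11 \<phi>12 \<phi>21 \<phi>22 :: "complex poly"
    and U :: "form ^ 2"
    and \<Phi> \<Psi> :: "complex poly ^ 2 ^ 2"
  assumes "two_orthogonal_with \<beta> \<alpha> \<gamma> P"
    and "dual_sequence P u"
    and "lowering_op_order_one a0 a1 a2"
    and "\<And>n. lam (n + 1) = of_nat (n + 1) * coeff a1 0 + of_nat n * of_nat (n + 1) / 2 * coeff a2 1"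
    and "\<And>n. lam (n + 1) \<noteq> 0"
    and "\<And>n. diff_op a0 a1 a2 (P (n + 1)) = smult (lam (n + 1)) (P n)"
    and "E1 = smult (1 / \<gamma> 1) [:- \<beta> 0, 1:]"
    and "A0 = [:- (\<alpha> 1 / \<gamma> 1):]"
    and "B1 = - smult (\<alpha> 2 / (\<gamma> 1 * \<gamma> 2)) [:- \<beta> 0, 1:] - [:1 / \<gamma> 2:]"
    and "F1 = smult (1 / \<gamma> 2) ([:- \<beta> 1, 1:] + [:\<alpha> 2 * \<alpha> 1 / \<gamma> 1:])"
    and "E2 = smult (1 / \<gamma> 3) ([:- \<beta> 2, 1:] * E1 - smult (\<alpha> 3) B1)"
    and "A1 = - smult (1 / \<gamma> 3) (smult (\<alpha> 3) F1 + 1 + smult (\<alpha> 1 / \<gamma> 1) [:- \<beta> 2, 1:])"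
    and "\<phi>11 = [:1 / 2:] - smult (\<alpha> 1 * lam 2 / (2 * lam 1)) E1 - smult (\<gamma> 1 * lam 3 / (2 * lam 1)) B1"
    and "\<phi>12 = smult (1 / 2) [:- \<beta> 0, 1:]
           - smult (\<alpha> 1 * lam 2 / (2 * lam 1)) A0 - smult (\<gamma> 1 * lam 3 / (2 * lam 1)) F1"
    and "\<phi>21 = [:- \<beta> 1, 1:] * E1 - smult (\<alpha> 2 * lam 3 / lam 2) B1 - smult (\<gamma> 2 * lam 4 / lam 2) E2"
    and "\<phi>22 = [:- \<beta> 1, 1:] * A0 - smult (\<alpha> 2 * lam 3 / lam 2) F1 - smult (\<gamma> 2 * lam 4 / lam 2) A1"
    and "U = vector [u 0, u 1]"
    and "\<Phi> = vector [vector [\<phi>11, \<phi>12], vector [\<phi>21, \<phi>22]]"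
    and "\<Psi> = vector [vector [0, 1],
                    vector [smult (2 / \<gamma> 1) [:- \<beta> 0, 1:], [:- 2 * (\<alpha> 1 / \<gamma> 1):]]]"
  shows "form_vec_deriv (form_matrix_mult \<Phi> U) + form_matrix_mult \<Psi> U = 0
         \<and> two_classical_Hahn P"
proof -
  define a b0 b1 where "a = coeff a1 0" and "b0 = coeff a2 0" and "b1 = coeff a2 1"
  \<comment> \<open>Agrees with \<open>lam\<close> at positive indices and is 0 at index 0, where
    \<open>lam\<close> is unspecified.\<close>
  define L where "L n = of_nat n * a + of_nat n * (of_nat n - 1) / 2 * b1" for n
  have lam: "lam n = L n" if "n > 0" for n
    using assms(4)[of "n - 1"] that by (simp add: L_def a_def b1_def)
  have "a0 = 0" "a1 = [:a:]" "a2 = [:b0, b1:]"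
    using lowering_op_order_one_coeffs[OF assms(3)] by (simp_all only: a_def b0_def b1_def)
  then have diff_op: "diff_op a0 a1 a2 = (\<lambda>p. smult a (pderiv p) + smult (1 / 2) ([:b0, b1:] * pderiv (pderiv p)))"
    by (simp add: diff_op_def fun_eq_iff smult_add_right)
  have L_nonzero: "L n \<noteq> 0" if "n > 0" for n
    using assms(5)[of "n - 1"] lam[of n] that by simp
  have lower: "diff_op a0 a1 a2 (P (Suc n)) = smult (L (Suc n)) (P n)" for n
    using assms(6)[of n] lam[of "Suc n"] by simp
  interpret two_orthogonal_lowering P u \<beta> \<alpha> \<gamma> L a b0 b1 "diff_op a0 a1 a2"
    using diff_op assms(1,2) L_def L_nonzero lower by (rule two_orthogonal_lowering.intro)
  define x where "x n = [:- \<beta> n, 1:]" for n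
  note X = assms(7-16)[folded x_def]
  note g = gamma_nonzero[of 1] gamma_nonzero[of 2] gamma_nonzero[of 3]
  note ring = left_diff_distrib distrib_right mult_smult_left mult.assoc u_simps
  \<comment> \<open>Solving \<open>u_mult_X\<close> for its highest form, at 0, 1, 2 in turn, writes
    \<open>u 2\<close>, \<open>u 3\<close>, \<open>u 4\<close> through \<open>u 0\<close> and
    \<open>u 1\<close>; this is the origin of the six auxiliary polynomials.\<close>
  have u2: "u 2 q = u 0 (E1 * q) + u 1 (A0 * q)" for q
  proof -
    have "u 2 q = (u 0 (x 0 * q) - \<alpha> 1 * u 1 q) / \<gamma> 1"
      using u_mult_X[of 0 q] g by (simp add: x_def numeral_2_eq_2)
    moreover have "u 0 (E1 * q) = u 0 (x 0 * q) / \<gamma> 1" "u 1 (A0 * q) = - (\<alpha> 1 / \<gamma> 1) * u 1 q"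
      by (simp_all add: X u_simps)
    ultimately show ?thesis
      by (simp add: diff_divide_distrib)
  qed
  have u3: "u 3 q = u 0 (B1 * q) + u 1 (F1 * q)" for q
  proof -
    have "u 3 q = (u 1 (x 1 * q) - u 0 q - \<alpha> 2 * u 2 q) / \<gamma> 2"
      using u_mult_X[of 1 q] g by (simp add: x_def numeral_eq_Suc)
    moreover have "u 0 (B1 * q) = - \<alpha> 2 / \<gamma> 2 * u 0 (E1 * q) - u 0 q / \<gamma> 2"
      by (simp add: X ring)
    moreover have "u 1 (F1 * q) = (u 1 (x 1 * q) - \<alpha> 2 * u 1 (A0 * q)) / \<gamma> 2"
      by (simp add: X ring)
    ultimately show ?thesis
      by (simp add: u2[of q] diff_divide_distrib add_divide_distrib distrib_left)
  qed
  have u4: "u 4 q = u 0 (E2 * q) + u 1 (A1 * q)" for q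
  proof -
    have "u 4 q = (u 2 (x 2 * q) - u 1 q - \<alpha> 3 * u 3 q) / \<gamma> 3"
      using u_mult_X[of 2 q] g by (simp add: x_def numeral_eq_Suc)
    moreover have "u 0 (E2 * q) = (u 0 (E1 * (x 2 * q)) - \<alpha> 3 * u 0 (B1 * q)) / \<gamma> 3"
      by (simp add: X(5) ring mult.left_commute)
    moreover have "u 1 (A1 * q) = (u 1 (A0 * (x 2 * q)) - u 1 q - \<alpha> 3 * u 1 (F1 * q)) / \<gamma> 3"
      by (simp add: X(2,6) ring diff_divide_distrib add_divide_distrib)
    ultimately show ?thesis
      by (simp add: u2[of "x 2 * q"] u3[of q] diff_divide_distrib add_divide_distrib distrib_left)
  qed
  have L: "lam 1 = a" "lam 1 = L 1" "lam 2 = L 2" "lam 3 = L 3" "lam 4 = L 4" "L 0 = 0" "L 1 \<noteq> 0" "L 2 \<noteq> 0"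
    using L_nonzero[of 1] L_nonzero[of 2] by (simp_all add: lam L_def)
  have row1: "u 1 p = u 0 (\<phi>11 * pderiv p) + u 1 (\<phi>12 * pderiv p)" for p
  proof -
    define q where "q = pderiv p"
    have "u 1 p = 2 * L 1 * u 1 p / (2 * L 1)"
      using L(7) by simp
    \<comment> \<open>In \<open>u_pderiv\<close> at 0 the first factor is
      \<open>a - L 0 = L 1\<close>.\<close>
    also have "2 * L 1 * u 1 p = L 1 * u 0 q + L 1 * u 1 (x 0 * q) - \<alpha> 1 * L 2 * u 2 q - \<gamma> 1 * L 3 * u 3 q"
      using u_pderiv[of 0 p] L(1,2,6) by (simp add: x_def q_def numeral_eq_Suc)
    also have "\<dots> / (2 * L 1) = u 0 q / 2 + u 1 (x 0 * q) / 2 - \<alpha> 1 * L 2 / (2 * L 1) * u 2 q - \<gamma> 1 * L 3 / (2 * L 1) * u 3 q"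
      using L(7) by (simp add: diff_divide_distrib add_divide_distrib)
    finally have "u 1 p = \<dots>" .
    moreover have "u 0 (\<phi>11 * q) = u 0 q / 2 - \<alpha> 1 * L 2 / (2 * L 1) * u 0 (E1 * q) - \<gamma> 1 * L 3 / (2 * L 1) * u 0 (B1 * q)"
      unfolding X(7) L(2-5) by (simp add: ring)
    moreover have "u 1 (\<phi>12 * q) = u 1 (x 0 * q) / 2 - \<alpha> 1 * L 2 / (2 * L 1) * u 1 (A0 * q) - \<gamma> 1 * L 3 / (2 * L 1) * u 1 (F1 * q)"
      unfolding X(8) L(2-5) by (simp add: ring)
    ultimately show ?thesis
      by (simp add: u2[of q] u3[of q] q_def[symmetric] distrib_left)
  qed
  have row2: "2 * u 2 p = u 0 (\<phi>21 * pderiv p) + u 1 (\<phi>22 * pderiv p)" for p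
  proof -
    define q where "q = pderiv p"
    have "2 * u 2 p = 2 * L 2 * u 2 p / L 2"
      using L(8) by simp
    \<comment> \<open>In \<open>u_pderiv\<close> at 1 the \<open>u 1\<close> term drops out, since
      \<open>a = L 1\<close>.\<close>
    also have "2 * L 2 * u 2 p = L 2 * u 2 (x 1 * q) - \<alpha> 2 * L 3 * u 3 q - \<gamma> 2 * L 4 * u 4 q"
      using u_pderiv[of 1 p] L(1,2) by (simp add: x_def q_def numeral_eq_Suc)
    also have "\<dots> / L 2 = u 2 (x 1 * q) - \<alpha> 2 * L 3 / L 2 * u 3 q - \<gamma> 2 * L 4 / L 2 * u 4 q"
      using L(8) by (simp add: diff_divide_distrib add_divide_distrib)
    finally have "2 * u 2 p = \<dots>" .
    moreover have "u 0 (\<phi>21 * q) = u 0 (E1 * (x 1 * q)) - \<alpha> 2 * L 3 / L 2 * u 0 (B1 * q) - \<gamma> 2 * L 4 / L 2 * u 0 (E2 * q)"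
      unfolding X(9) L(2-5) by (simp add: ring mult.left_commute)
    moreover have "u 1 (\<phi>22 * q) = u 1 (A0 * (x 1 * q)) - \<alpha> 2 * L 3 / L 2 * u 1 (F1 * q) - \<gamma> 2 * L 4 / L 2 * u 1 (A1 * q)"
      unfolding X(10) L(2-5) by (simp add: ring mult.left_commute)
    ultimately show ?thesis
      using u2[of "x 1 * q"] by (simp add: u3[of q] u4[of q] q_def[symmetric] distrib_left)
  qed
  \<comment> \<open>The second row of \<open>\<Psi>\<close> is twice the pair \<open>E1\<close>,
    \<open>A0\<close>, so it represents \<open>2 * u 2\<close>.\<close>
  have psi2: "2 * u 2 p = u 0 (smult (2 / \<gamma> 1) [:- \<beta> 0, 1:] * p) + u 1 ([:- 2 * (\<alpha> 1 / \<gamma> 1):] * p)" for p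
    unfolding u2 X(1,2) x_def[symmetric] by (simp add: u_simps)
  have "form_vec_deriv (form_matrix_mult \<Phi> U) + form_matrix_mult \<Psi> U = 0"
    unfolding vec_eq_iff forall_2
  proof (intro conjI ext)
    fix p
    let ?lhs = "form_vec_deriv (form_matrix_mult \<Phi> U) + form_matrix_mult \<Psi> U"
    note defs = form_vec_deriv_def form_matrix_mult_def form_deriv_def form_mult_def assms(17-19)
    have "(?lhs $ 1) p = - (u 0 (\<phi>11 * pderiv p) + u 1 (\<phi>12 * pderiv p)) + u 1 p"
      by (simp add: defs sum_2 u_simps)
    also have "\<dots> = 0"
      unfolding row1[symmetric] by simp
    finally show "(?lhs $ 1) p = (0 $ 1) p"
      by simp
    have "(?lhs $ 2) p = - (u 0 (\<phi>21 * pderiv p) + u 1 (\<phi>22 * pderiv p)) +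
        (u 0 (smult (2 / \<gamma> 1) [:- \<beta> 0, 1:] * p) + u 1 ([:- 2 * (\<alpha> 1 / \<gamma> 1):] * p))"
      by (simp add: defs sum_2)
    also have "\<dots> = 0"
      unfolding row2[symmetric] psi2[symmetric] by simp
    finally show "(?lhs $ 2) p = (0 $ 2) p"
      by simp
  qed
  with two_classical_Hahn show ?thesis by simp
qed

end
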